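(* Let $H$ be a real Hilbert space, let $C\subset H$ be nonempty, closed and convex, and let $G:H\to H$ be a mapping. Assume that for some $\gamma>0$ the mapping $$T=P_C(I-\gamma G):H\to H$$ is a $(k,a)$-enriched Bianchini mapping for some $k\in[0,\infty)$ and $a\in[0,1)$. Then the variational inequality problem $VIP(G,C)$ has a unique solution $x^*$, and there exists $\lambda\in[0,1)$ such that, for any $x_0\in C$, the sequence $\{x_n\}$ defined by $$x_{n+1}=(1-\lambda)x_n+\lambda P_C(I-\gamma G)x_n,\quad n\ge 0,$$ converges strongly (in norm) to $x^*$.
   Context: $P_C$ denotes the nearest point projection onto $C$ and $I$ the identity map. The variational inequality problem $VIP(G,C)$ is to find $x^*\in C$ such that $$\langle Gx^*,x-x^*\rangle\ge 0\quad\text{for all }x\in C.$$ For a normed linear space $(X,\|\cdot\|)$, a mapping $T:X\to X$ is called a $(k,a)$-enriched Bianchini mapping, where $k\in[0,\infty)$ and $a\in[0,1)$, if $$\|k(x-y)+Tx-Ty\|\le a\max\left\{\|x-Tx\|,\|y-Ty\|\right\}\quad\text{for all }x,y\in X.$$ *)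

theory Defs
  imports "HOL-Analysis.Analysis"
begin

(* The library's closest_point requires the class heine_borel, which would force
   finite dimension.  The definite description is well defined whenever C is a nonempty
   closed convex subset of a Hilbert space. *)
definition proj_on :: "'a::metric_space set \<Rightarrow> 'a \<Rightarrow> 'a" where
  "proj_on C x = (THE y. y \<in> C \<and> (\<forall>z\<in>C. dist x y \<le> dist x z))"

definition VIP_solution :: "('a::real_inner \<Rightarrow> 'a) \<Rightarrow> 'a set \<Rightarrow> 'a \<Rightarrow> bool" where
  "VIP_solution G C u \<longleftrightarrow> u \<in> C \<and> (\<forall>x\<in>C. G u \<bullet> (x - u) \<ge> 0)"

definition enriched_Bianchini :: "real \<Rightarrow> real \<Rightarrow> ('a::real_normed_vector \<Rightarrow> 'a) \<Rightarrow> bool" where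
  "enriched_Bianchini k a T \<longleftrightarrow> 0 \<le> k \<and> 0 \<le> a \<and> a < 1 \<and>
     (\<forall>x y. norm (k *\<^sub>R (x - y) + T x - T y) \<le> a * max (norm (x - T x)) (norm (y - T y)))"

end

theory Submission
  imports Defs
begin

text \<open>
  A point \<open>u\<close> solves \<open>VIP(G,C)\<close> exactly when it is a fixed point of
  \<open>T = P\<^sub>C(I - \<gamma>G)\<close>: by the obtuse-angle description of the projection, \<open>u = P\<^sub>C(u - \<gamma> G u)\<close>
  means \<open>\<langle>-\<gamma> G u, z - u\<rangle> \<le> 0\<close> for all \<open>z \<in> C\<close> (\<open>VIP_solution_iff_fixed_point\<close>). The projection
  exists because a minimizing sequence is Cauchy by the parallelogram law
  (\<open>nearest_point_exists\<close>). It remains to find the fixed points of \<open>T\<close> by iteration.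

  For \<open>l = 1/(k+1)\<close> the averaged map \<open>S = (1-l)I + lT\<close> satisfies
  \<open>S x - S y = l (k (x - y) + T x - T y)\<close> and \<open>x - S x = l (x - T x)\<close>, so the enriched condition
  on \<open>T\<close> is the plain Bianchini condition on \<open>S\<close>, with the same fixed points
  (\<open>enriched_Bianchini_averaged\<close>). A Bianchini map on a complete space has a unique fixed point
  that attracts all orbits: consecutive steps of an orbit shrink by the factor \<open>a\<close>, and the
  distance between two orbit points is controlled by the lengths of the steps leading to them
  (\<open>Bianchini_fixed_point\<close>).

  The choice \<open>l = 1/(k+1)\<close> is below \<open>1\<close> only for \<open>k > 0\<close>. A plain Bianchini map
  (\<open>k = 0\<close>) is however also enriched with some small \<open>k > 0\<close> and a larger \<open>a < 1\<close>,
  since the condition itself bounds \<open>\<parallel>x - y\<parallel>\<close> by a multiple of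
  \<open>max \<parallel>x - T x\<parallel> \<parallel>y - T y\<parallel>\<close> (\<open>enriched_Bianchini_zero_perturb\<close>).
\<close>

section \<open>Projections and variational inequalities\<close>

text \<open>By the parallelogram law, two points of \<open>C\<close> that both nearly attain the distance \<open>d\<close> from
  \<open>x\<close> are close together, because their midpoint lies in \<open>C\<close> and cannot be nearer than \<open>d\<close>.
  So a minimizing sequence is Cauchy, and completeness supplies the minimizer.\<close>

lemma nearest_point_exists:
  fixes C :: "'a::{real_inner, complete_space} set"
  assumes "C \<noteq> {}" and "closed C" and "convex C"
  obtains y where "y \<in> C" and "\<And>z. z \<in> C \<Longrightarrow> dist x y \<le> dist x z"
proof -
  define d where "d = infdist x C"
  have d_le: "d \<le> dist x z" if "z \<in> C" for z
    using that by (simp add: d_def infdist_le)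
  have d_nonneg: "0 \<le> d" by (simp add: d_def infdist_nonneg)
  have "\<exists>y\<in>C. (dist x y)\<^sup>2 < d\<^sup>2 + 1 / real (Suc n)" for n
  proof -
    have "d < sqrt (d\<^sup>2 + 1 / real (Suc n))"
      by (rule real_less_rsqrt) simp
    then obtain y where "y \<in> C" and "dist x y < sqrt (d\<^sup>2 + 1 / real (Suc n))"
      using \<open>C \<noteq> {}\<close> cInf_lessD[of "dist x ` C"] by (auto simp: d_def infdist_def)
    moreover have "0 \<le> d\<^sup>2 + 1 / real (Suc n)" by simp
    ultimately show ?thesis
      by (metis real_sqrt_pow2 power_strict_mono zero_le_dist zero_less_numeral)
  qed
  then obtain y where yC: "\<And>n. y n \<in> C"
    and y_near: "\<And>n. (dist x (y n))\<^sup>2 < d\<^sup>2 + 1 / real (Suc n)"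
    by metis
  have close: "(norm (y m - y n))\<^sup>2 \<le> 4 / real (Suc N)" if "N \<le> m" "N \<le> n" for m n N
  proof -
    let ?mid = "(1/2) *\<^sub>R y m + (1/2) *\<^sub>R y n"
    have "?mid \<in> C"
      using convexD[OF \<open>convex C\<close> yC yC, of "1/2" "1/2"] by simp
    then have "d\<^sup>2 \<le> (norm (x - ?mid))\<^sup>2"
      using d_le d_nonneg by (simp add: dist_norm power_mono)
    moreover have "(norm (y m - y n))\<^sup>2
        = 2 * (norm (x - y m))\<^sup>2 + 2 * (norm (x - y n))\<^sup>2 - 4 * (norm (x - ?mid))\<^sup>2"
      by (simp add: power2_norm_eq_inner inner_diff inner_add inner_commute algebra_simps)
    moreover have "1 / real (Suc m) \<le> 1 / real (Suc N)" "1 / real (Suc n) \<le> 1 / real (Suc N)"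
      using that by (simp_all add: frac_le)
    ultimately show ?thesis
      using y_near[of m] y_near[of n] unfolding dist_norm by linarith
  qed
  have "Cauchy y"
  proof (rule CauchyI)
    fix e :: real assume "0 < e"
    obtain N where "inverse (real (Suc N)) < e\<^sup>2 / 4"
      using reals_Archimedean[of "e\<^sup>2 / 4"] \<open>0 < e\<close> by auto
    then have N: "4 / real (Suc N) < e\<^sup>2" by (simp add: field_simps)
    have "norm (y m - y n) < e" if "N \<le> m" "N \<le> n" for m n
      using le_less_trans[OF close[OF that] N] \<open>0 < e\<close> power_less_imp_less_base[of _ 2 e] by simp
    then show "\<exists>N. \<forall>m\<ge>N. \<forall>n\<ge>N. norm (y m - y n) < e" by blast
  qed
  then obtain p where p: "y \<longlonglongrightarrow> p"
    using Cauchy_convergent convergent_def by blast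
  have "p \<in> C"
    using closed_sequentially[OF \<open>closed C\<close>] yC p by blast
  have "(dist x p)\<^sup>2 \<le> d\<^sup>2 + 0"
  proof (rule LIMSEQ_le)
    show "(\<lambda>n. (dist x (y n))\<^sup>2) \<longlonglongrightarrow> (dist x p)\<^sup>2"
      by (intro tendsto_intros p)
    show "(\<lambda>n. d\<^sup>2 + 1 / real (Suc n)) \<longlonglongrightarrow> d\<^sup>2 + 0"
      using LIMSEQ_inverse_real_of_nat
      by (intro tendsto_add tendsto_const) (simp add: inverse_eq_divide)
    show "\<exists>N. \<forall>n\<ge>N. (dist x (y n))\<^sup>2 \<le> d\<^sup>2 + 1 / real (Suc n)"
      using y_near less_imp_le by blast
  qed
  then have "dist x p \<le> d"
    using d_nonneg power2_le_imp_le by simp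
  with \<open>p \<in> C\<close> d_le that show thesis
    by (meson order_trans)
qed

text \<open>The obtuse-angle criterion. One direction is the first-order condition at a minimizer;
  for the other, expanding the square gives
  \<open>\<parallel>x - z\<parallel>\<^sup>2 \<ge> \<parallel>x - y\<parallel>\<^sup>2 + \<parallel>y - z\<parallel>\<^sup>2\<close>, so \<open>y\<close> is a nearest point. Existence and uniqueness of
  nearest points turn the definite description behind \<^const>\<open>proj_on\<close> into an honest value.\<close>

lemma proj_on_eq_iff:
  fixes C :: "'a::{real_inner, complete_space} set"
  assumes "C \<noteq> {}" and "closed C" and "convex C"
  shows "proj_on C x = y \<longleftrightarrow> y \<in> C \<and> (\<forall>z\<in>C. (x - y) \<bullet> (z - y) \<le> 0)"
proof -
  let ?nearest = "\<lambda>y. y \<in> C \<and> (\<forall>z\<in>C. dist x y \<le> dist x z)"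
  have unique: "\<exists>!y. ?nearest y"
    using nearest_point_exists[OF assms, of x] any_closest_point_unique[OF assms(3,2)] by metis
  have "proj_on C x = y \<longleftrightarrow> ?nearest y"
    using theI'[OF unique] the1_equality[OF unique, of y] unfolding proj_on_def by blast
  also have "\<dots> \<longleftrightarrow> y \<in> C \<and> (\<forall>z\<in>C. (x - y) \<bullet> (z - y) \<le> 0)"
  proof (intro conj_cong refl iffI ballI)
    fix z assume "y \<in> C" "\<forall>z\<in>C. dist x y \<le> dist x z" "z \<in> C"
    then show "(x - y) \<bullet> (z - y) \<le> 0"
      using any_closest_point_dot[OF assms(3,2)] by blast
  next
    fix z assume obtuse: "\<forall>z\<in>C. (x - y) \<bullet> (z - y) \<le> 0" and "z \<in> C"
    have "(norm (x - z))\<^sup>2 = (norm (x - y))\<^sup>2 + (norm (z - y))\<^sup>2 - 2 * ((x - y) \<bullet> (z - y))"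
      by (simp add: power2_norm_eq_inner inner_diff inner_commute algebra_simps)
    moreover have "(x - y) \<bullet> (z - y) \<le> 0" using obtuse \<open>z \<in> C\<close> by blast
    ultimately have "(norm (x - y))\<^sup>2 \<le> (norm (x - z))\<^sup>2"
      using zero_le_power2[of "norm (z - y)"] by linarith
    then show "dist x y \<le> dist x z"
      unfolding dist_norm by (rule power2_le_imp_le) simp
  qed
  finally show ?thesis .
qed

lemma VIP_solution_iff_fixed_point:
  fixes C :: "'a::{real_inner, complete_space} set"
  assumes "C \<noteq> {}" and "closed C" and "convex C" and "\<gamma> > 0"
  shows "VIP_solution G C u \<longleftrightarrow> proj_on C (u - \<gamma> *\<^sub>R G u) = u"
  using \<open>\<gamma> > 0\<close> by (simp add: proj_on_eq_iff[OF assms(1-3)] VIP_solution_def zero_le_mult_iff)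

section \<open>Enriched Bianchini mappings\<close>

text \<open>The constant \<open>k\<close> can be moved off zero because, by the triangle inequality through
  \<open>T x\<close> and \<open>T y\<close>, \<open>\<parallel>x - y\<parallel> \<le> (2 + a) max \<parallel>x - T x\<parallel> \<parallel>y - T y\<parallel>\<close>. The extra term
  \<open>k (x - y)\<close> then raises \<open>a\<close> by at most \<open>k (2 + a)\<close>, which is small for small \<open>k\<close>.\<close>

lemma enriched_Bianchini_zero_perturb:
  fixes T :: "'a::real_normed_vector \<Rightarrow> 'a"
  assumes "enriched_Bianchini 0 a T"
  obtains k' a' where "k' > 0" and "enriched_Bianchini k' a' T"
proof -
  have a: "0 \<le> a" "a < 1"
    and T: "norm (T x - T y) \<le> a * max (norm (x - T x)) (norm (y - T y))" for x y
    using assms by (auto simp: enriched_Bianchini_def)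
  \<comment> \<open>This value puts the new contraction constant halfway between \<open>a\<close> and \<open>1\<close>.\<close>
  define k' where "k' = (1 - a) / (2 * (2 + a))"
  have "k' > 0" using a by (simp add: k'_def)
  have a': "a + k' * (2 + a) = (1 + a) / 2"
    using a by (simp add: k'_def field_simps)
  have "norm (k' *\<^sub>R (x - y) + T x - T y)
      \<le> (1 + a) / 2 * max (norm (x - T x)) (norm (y - T y))" for x y
  proof -
    let ?M = "max (norm (x - T x)) (norm (y - T y))"
    have "norm (x - y) \<le> norm (x - T x) + norm (T x - T y) + norm (y - T y)"
      using norm_triangle_ineq4[of "(x - T x) + (T x - T y)" "y - T y"]
        norm_triangle_ineq[of "x - T x" "T x - T y"]
      by simp
    also have "\<dots> \<le> (2 + a) * ?M"
      using T[of x y] by (simp add: distrib_right)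
    finally have "k' * norm (x - y) \<le> k' * ((2 + a) * ?M)"
      using \<open>k' > 0\<close> by simp
    moreover have "norm (k' *\<^sub>R (x - y) + T x - T y) \<le> k' * norm (x - y) + norm (T x - T y)"
      using norm_triangle_ineq[of "k' *\<^sub>R (x - y)" "T x - T y"] \<open>k' > 0\<close>
      by (simp add: add_diff_eq)
    ultimately have "norm (k' *\<^sub>R (x - y) + T x - T y) \<le> (a + k' * (2 + a)) * ?M"
      using T[of x y] by (simp add: algebra_simps)
    then show ?thesis by (simp only: a')
  qed
  then have "enriched_Bianchini k' ((1 + a) / 2) T"
    using a \<open>k' > 0\<close> by (simp add: enriched_Bianchini_def)
  with \<open>k' > 0\<close> that show thesis by blast
qed

text \<open>Averaging absorbs the enrichment: for \<open>l = 1/(k+1)\<close> the weight \<open>1 - l\<close> of the identity is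
  \<open>l k\<close>, so differences of the averaged map are \<open>l\<close> times the enriched differences of \<open>T\<close>,
  while its displacements are \<open>l\<close> times those of \<open>T\<close>.\<close>

lemma enriched_Bianchini_averaged:
  fixes T :: "'a::real_normed_vector \<Rightarrow> 'a"
  assumes "enriched_Bianchini k a T"
  defines "l \<equiv> 1 / (k + 1)"
  shows "enriched_Bianchini 0 a (\<lambda>x. (1 - l) *\<^sub>R x + l *\<^sub>R T x)"
proof -
  let ?S = "\<lambda>x. (1 - l) *\<^sub>R x + l *\<^sub>R T x"
  have k: "0 \<le> k" and a: "0 \<le> a" "a < 1"
    and T: "norm (k *\<^sub>R (x - y) + T x - T y) \<le> a * max (norm (x - T x)) (norm (y - T y))" for x y
    using assms(1) by (auto simp: enriched_Bianchini_def)
  have l: "0 \<le> l" "1 - l = l * k"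
    using k by (simp_all add: l_def field_simps)
  have displacement: "norm (z - ?S z) = l * norm (z - T z)" for z
  proof -
    have "z - ?S z = l *\<^sub>R (z - T z)" by (simp add: algebra_simps)
    then show ?thesis using l(1) by simp
  qed
  have "norm (?S x - ?S y) \<le> a * max (norm (x - ?S x)) (norm (y - ?S y))" for x y
  proof -
    have "?S x - ?S y = l *\<^sub>R (k *\<^sub>R (x - y) + T x - T y)"
      unfolding l(2) by (simp add: algebra_simps)
    then have "norm (?S x - ?S y) = l * norm (k *\<^sub>R (x - y) + T x - T y)"
      using l(1) by simp
    also have "\<dots> \<le> l * (a * max (norm (x - T x)) (norm (y - T y)))"
      using T l(1) by (rule mult_left_mono)
    also have "\<dots> = a * max (l * norm (x - T x)) (l * norm (y - T y))"
      using l(1) a(1) by (simp add: max_mult_distrib_left mult.left_commute)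
    finally show ?thesis by (simp only: displacement)
  qed
  with a show ?thesis by (simp add: enriched_Bianchini_def)
qed

text \<open>If the maximum in the Bianchini condition for two consecutive orbit points were the new
  step, that step would be at most \<open>a < 1\<close> times itself, hence zero; so the old step governs.\<close>

lemma Bianchini_orbit_steps:
  fixes S :: "'a::real_normed_vector \<Rightarrow> 'a"
  assumes "enriched_Bianchini 0 a S" and "\<And>n. x (Suc n) = S (x n)"
  shows "norm (x n - x (Suc n)) \<le> a ^ n * norm (x 0 - x 1)"
proof (induction n)
  case (Suc n)
  let ?old = "norm (x n - x (Suc n))" and ?new = "norm (x (Suc n) - x (Suc (Suc n)))"
  have a: "0 \<le> a" "a < 1" and step: "?new \<le> a * max ?old ?new"
    using assms by (auto simp: enriched_Bianchini_def)
  have "?new \<le> a * ?old"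
  proof (cases "?old \<le> ?new")
    case True
    then have "(1 - a) * ?new \<le> 0"
      using step by (simp add: max_absorb2 left_diff_distrib)
    then have "?new = 0"
      using a by (simp add: mult_le_0_iff)
    then show ?thesis using a by simp
  next
    case False
    then show ?thesis using step by (simp add: max_absorb1)
  qed
  also have "\<dots> \<le> a * (a ^ n * norm (x 0 - x 1))"
    using Suc.IH a by (rule_tac mult_left_mono)
  finally show ?case by (simp add: mult.assoc)
qed simp

text \<open>The Bianchini condition applied to the predecessors of two orbit points bounds their
  distance by earlier steps, so no summation of a geometric series is needed to see that an orbit
  is Cauchy. The map itself need not be continuous; that the limit is fixed comes from
  the same condition applied to the limit and an orbit point.\<close>

theorem Bianchini_fixed_point:
  fixes S :: "'a::{real_normed_vector, complete_space} \<Rightarrow> 'a"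
  assumes S: "enriched_Bianchini 0 a S"
  obtains u where "\<And>v. S v = v \<longleftrightarrow> v = u"
    and "\<And>x. (\<And>n. x (Suc n) = S (x n)) \<Longrightarrow> x \<longlonglongrightarrow> u"
proof -
  have a: "0 \<le> a" "a < 1"
    and contr: "norm (S x - S y) \<le> a * max (norm (x - S x)) (norm (y - S y))" for x y
    using S by (auto simp: enriched_Bianchini_def)
  have pow: "(\<lambda>n. a ^ n * c) \<longlonglongrightarrow> 0" for c
    using a by (auto intro!: tendsto_mult_left_zero LIMSEQ_realpow_zero)
  have steps_0: "(\<lambda>n. norm (x n - S (x n))) \<longlonglongrightarrow> 0"
    if orbit: "\<And>n. x (Suc n) = S (x n)" for x :: "nat \<Rightarrow> 'a"
    using Bianchini_orbit_steps[OF S, of x] orbit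
    by (intro tendsto_sandwich[OF _ _ tendsto_const pow[of "norm (x 0 - x 1)"]]) auto

  define x where "x = (\<lambda>n. (S ^^ n) 0)"
  have orbit: "x (Suc n) = S (x n)" for n by (simp add: x_def)
  have "Cauchy x"
  proof (rule CauchyI)
    fix e :: real assume "0 < e"
    then obtain N where N: "norm (x n - S (x n)) < e" if "N \<le> n" for n
      using order_tendstoD(2)[OF steps_0[of x, OF orbit]] by (auto simp: eventually_sequentially)
    have "norm (x m - x n) < e" if mn: "Suc N \<le> m" "Suc N \<le> n" for m n
    proof -
      obtain m' n' where m': "m = Suc m'" "N \<le> m'" and n': "n = Suc n'" "N \<le> n'"
        using mn by (metis Suc_le_D Suc_le_mono)
      have "norm (x m - x n) \<le> a * max (norm (x m' - S (x m'))) (norm (x n' - S (x n')))"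
        using contr by (simp add: m' n' orbit)
      also have "\<dots> \<le> max (norm (x m' - S (x m'))) (norm (x n' - S (x n')))"
        using a by (intro mult_left_le_one_le) (auto simp: le_max_iff_disj)
      also have "\<dots> < e" using N m' n' by simp
      finally show ?thesis .
    qed
    then show "\<exists>N. \<forall>m\<ge>N. \<forall>n\<ge>N. norm (x m - x n) < e" by blast
  qed
  then obtain u where u: "x \<longlonglongrightarrow> u"
    using Cauchy_convergent convergent_def by blast
  have "norm (u - S u) \<le> a * max 0 (norm (u - S u))"
  proof (rule LIMSEQ_le)
    show "(\<lambda>n. norm (x (Suc n) - S u)) \<longlonglongrightarrow> norm (u - S u)"
      by (intro tendsto_intros LIMSEQ_Suc u)
    show "(\<lambda>n. a * max (norm (x n - S (x n))) (norm (u - S u)))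
        \<longlonglongrightarrow> a * max 0 (norm (u - S u))"
      by (intro tendsto_intros steps_0[of x, OF orbit])
    show "\<exists>N. \<forall>n\<ge>N. norm (x (Suc n) - S u) \<le> a * max (norm (x n - S (x n))) (norm (u - S u))"
      using contr by (simp add: orbit)
  qed
  then have "(1 - a) * norm (u - S u) \<le> 0"
    by (simp add: left_diff_distrib)
  then have fix_u: "S u = u"
    using a by (simp add: mult_le_0_iff)
  have uniq: "v = u" if "S v = v" for v
    using contr[of v u] by (simp add: that fix_u)
  have "z \<longlonglongrightarrow> u" if z: "\<And>n. z (Suc n) = S (z n)" for z
  proof -
    have "norm (z (Suc n) - u) \<le> a * norm (z n - S (z n))" for n
      using contr[of "z n" u] by (simp add: z fix_u)
    then have "(\<lambda>n. z (Suc n) - u) \<longlonglongrightarrow> 0"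
      by (intro Lim_null_comparison[OF _ tendsto_mult_right_zero[OF steps_0[of z, OF z], of a]])
        simp
    then have "(\<lambda>n. z (Suc n)) \<longlonglongrightarrow> u" by (simp add: LIM_zero_iff)
    then show ?thesis by (rule LIMSEQ_imp_Suc)
  qed
  with uniq fix_u that show thesis by blast
qed

section \<open>Solving the variational inequality\<close>

theorem theorem5:
  fixes C :: "'a::{real_inner, complete_space} set"
    and G :: "'a \<Rightarrow> 'a"
    and \<gamma> k a :: real
  assumes "C \<noteq> {}" and "closed C" and "convex C"
    and "\<gamma> > 0"
    and "enriched_Bianchini k a (\<lambda>x. proj_on C (x - \<gamma> *\<^sub>R G x))"
  shows "\<exists>u. VIP_solution G C u \<and> (\<forall>v. VIP_solution G C v \<longrightarrow> v = u) \<and>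
    (\<exists>l::real. 0 \<le> l \<and> l < 1 \<and>
      (\<forall>x :: nat \<Rightarrow> 'a. x 0 \<in> C \<longrightarrow>
        (\<forall>n. x (Suc n) = (1 - l) *\<^sub>R x n + l *\<^sub>R proj_on C (x n - \<gamma> *\<^sub>R G (x n))) \<longrightarrow>
        x \<longlonglongrightarrow> u))"
proof -
  let ?T = "\<lambda>x. proj_on C (x - \<gamma> *\<^sub>R G x)"
  obtain k' a' where "k' > 0" and enriched: "enriched_Bianchini k' a' ?T"
  proof (cases "k = 0")
    case True
    with assms(5) that show thesis
      using enriched_Bianchini_zero_perturb by blast
  next
    case False
    with assms(5) have "k > 0" by (simp add: enriched_Bianchini_def)
    with assms(5) that show thesis by blast
  qed
  define l where "l = 1 / (k' + 1)"
  have l: "0 < l" "l < 1"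
    using \<open>k' > 0\<close> by (simp_all add: l_def)
  let ?S = "\<lambda>x. (1 - l) *\<^sub>R x + l *\<^sub>R ?T x"
  have "enriched_Bianchini 0 a' ?S"
    unfolding l_def by (rule enriched_Bianchini_averaged[OF enriched])
  then obtain u where fixed: "\<And>v. ?S v = v \<longleftrightarrow> v = u"
    and attracts: "\<And>x. (\<And>n. x (Suc n) = ?S (x n)) \<Longrightarrow> x \<longlonglongrightarrow> u"
    using Bianchini_fixed_point by blast
  have "?S v = v \<longleftrightarrow> ?T v = v" for v
  proof -
    have "?S v - v = l *\<^sub>R (?T v - v)" by (simp add: algebra_simps)
    then show ?thesis
      using l(1) by (metis eq_iff_diff_eq_0 less_irrefl scaleR_eq_0_iff)
  qed
  then have "VIP_solution G C v \<longleftrightarrow> v = u" for v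
    using fixed VIP_solution_iff_fixed_point[OF assms(1-4)] by simp
  moreover have "\<forall>x :: nat \<Rightarrow> 'a. x 0 \<in> C \<longrightarrow> (\<forall>n. x (Suc n) = ?S (x n)) \<longrightarrow> x \<longlonglongrightarrow> u"
    using attracts by blast
  ultimately show ?thesis
    using l less_imp_le by blast
qed

end
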